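(* For every $n\ge 0$ there is a bijection $\Psi:\mathfrak{S}_n\rightarrow\mathcal{W}_n$ such that a permutation $\sigma\in\mathfrak{S}_n$ with $i$ inversions, $j$ fixed points, $k$ excedances and depth $\ell$ is carried to a weighted 3-colored Motzkin path $\mu\in\mathcal{W}_n$ with weight $\omega(\mu)=q^{i}p^{j}s^{k}t^{\ell}$. Consequently, \[ \sum_{n\ge 0}\left(\sum_{\sigma\in\mathfrak{S}_n} q^{\mathsf{inv}(\sigma)} p^{\mathsf{fix}(\sigma)} s^{\mathsf{exc}(\sigma)} t^{\mathsf{depth}(\sigma)}\right)z^n=\mathfrak{F}(\gamma_h,\lambda_h) \] with $\lambda_{h} = s\,[h]_q^2\,(qt)^{2h-1}$ for $h\ge1$ and $\gamma_h = \big((1+s)[h]_q+pq^h\big)(qt)^h$ for $h\ge 0$.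
   Context: $\mathfrak{S}_n$ is the symmetric group of permutations $\sigma=\sigma(1)\cdots\sigma(n)$ of $[n]=\{1,\dots,n\}$. An inversion of $\sigma$ is a pair $(i,j)$ with $1\le i<j\le n$ and $\sigma(i)>\sigma(j)$; $\mathsf{inv}(\sigma)$ is the number of inversions. An index $i$ is an excedance if $\sigma(i)>i$ and a fixed point if $\sigma(i)=i$; $\mathsf{exc}(\sigma)$ and $\mathsf{fix}(\sigma)$ count them. The depth is $\mathsf{depth}(\sigma)=\sum_{i:\sigma(i)>i}(\sigma(i)-i)$. For $k\ge1$, $[k]_q=1+q+\cdots+q^{k-1}$, and $[0]_q=0$. A Motzkin path of length $n$ is a lattice path from $(0,0)$ to $(n,0)$ staying weakly above the $x$-axis, with up steps $U=(1,1)$, down steps $D=(1,-1)$ and horizontal steps $(1,0)$. A 3-colored Motzkin path has three kinds of horizontal steps $H_1,H_2,H_3$. The height of a step is the maximum $y$-coordinate it attains; $x^{(h)}$ denotes a step of type $x$ at height $h$. $\mathcal{W}_n$ is the set of 3-colored Motzkin paths of length $n$ together with an assignment to each step of a weight $\omega$ from the following allowed sets: $\omega(H_3^{(0)})=p$; for $h\ge1$: $\omega(U^{(h)})\in\{st^{2h-1}q^{a}:0\le a\le h-1\}$, $\omega(D^{(h)})\in\{q^{2h-1+a}:0\le a\le h-1\}$, $\omega(H_1^{(h)})\in\{st^hq^{h+a}:0\le a\le h-1\}$, $\omega(H_2^{(h)})\in\{t^hq^{h+a}:0\le a\le h-1\}$, $\omega(H_3^{(h)})=pt^hq^{2h}$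 (in particular steps $H_1,H_2$ at height $0$ do not occur). The weight $\omega(\mu)$ of $\mu\in\mathcal{W}_n$ is the product of the weights of its steps. For sequences $\{\gamma_h\}_{h\ge0}$, $\{\lambda_h\}_{h\ge1}$, $\mathfrak{F}(\gamma_h,\lambda_h)$ denotes the formal power series in $z$ given by the Jacobi continued fraction \[ \mathfrak{F}(\gamma_h,\lambda_h)=\cfrac{1}{1-\gamma_0 z-\cfrac{\lambda_1 z^2}{1-\gamma_1 z-\cfrac{\lambda_2 z^2}{1-\gamma_2 z-\cdots}}}. \] *)

theory Defs
  imports
    "HOL-Combinatorics.Permutations"
    "HOL-Library.Poly_Mapping"
    "HOL-Computational_Algebra.Formal_Power_Series"
begin

section \<open>The polynomial ring in the indeterminates q, p, s, t over the integers\<close>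

text \<open>
  A polynomial is a finitely supported map from exponent vectors to integer coefficients, with
  convolution as product. Weights are thus formal monomials, so that distinct exponents
  give distinct weights.
\<close>

datatype indet = Ind_q | Ind_p | Ind_s | Ind_t

type_synonym polyn = "(indet \<Rightarrow>\<^sub>0 nat) \<Rightarrow>\<^sub>0 int"

definition indet :: "indet \<Rightarrow> polyn" where
  "indet x = Poly_Mapping.single (Poly_Mapping.single x 1) 1"

abbreviation X\<^sub>q :: polyn where "X\<^sub>q \<equiv> indet Ind_q"
abbreviation X\<^sub>p :: polyn where "X\<^sub>p \<equiv> indet Ind_p"
abbreviation X\<^sub>s :: polyn where "X\<^sub>s \<equiv> indet Ind_s"
abbreviation X\<^sub>t :: polyn where "X\<^sub>t \<equiv> indet Ind_t"

definition q_int :: "nat \<Rightarrow> polyn" where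
  "q_int k = (\<Sum>i<k. X\<^sub>q ^ i)"


section \<open>Permutation statistics\<close>

definition perms :: "nat \<Rightarrow> (nat \<Rightarrow> nat) set" where
  "perms n = {\<sigma>. \<sigma> permutes {1..n}}"

definition inv_stat :: "nat \<Rightarrow> (nat \<Rightarrow> nat) \<Rightarrow> nat" where
  "inv_stat n \<sigma> = card {(i, j). 1 \<le> i \<and> i < j \<and> j \<le> n \<and> \<sigma> i > \<sigma> j}"

definition fix_stat :: "nat \<Rightarrow> (nat \<Rightarrow> nat) \<Rightarrow> nat" where
  "fix_stat n \<sigma> = card {i \<in> {1..n}. \<sigma> i = i}"

definition exc_stat :: "nat \<Rightarrow> (nat \<Rightarrow> nat) \<Rightarrow> nat" where
  "exc_stat n \<sigma> = card {i \<in> {1..n}. \<sigma> i > i}"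

definition depth_stat :: "nat \<Rightarrow> (nat \<Rightarrow> nat) \<Rightarrow> nat" where
  "depth_stat n \<sigma> = (\<Sum>i \<in> {i \<in> {1..n}. \<sigma> i > i}. \<sigma> i - i)"


section \<open>Weighted 3-colored Motzkin paths\<close>

datatype step = Up | Down | H1 | H2 | H3

fun rise :: "step \<Rightarrow> int" where
  "rise Up = 1"
| "rise Down = - 1"
| "rise H1 = 0"
| "rise H2 = 0"
| "rise H3 = 0"

definition altitude :: "step list \<Rightarrow> nat \<Rightarrow> int" where
  "altitude w i = (\<Sum>k<i. rise (w ! k))"

definition motzkin_paths :: "nat \<Rightarrow> step list set" where
  "motzkin_paths n =
     {w. length w = n \<and> (\<forall>i\<le>n. altitude w i \<ge> 0) \<and> altitude w n = 0}"

definition step_height :: "step list \<Rightarrow> nat \<Rightarrow> nat" where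
  "step_height w i = nat (max (altitude w i) (altitude w (Suc i)))"

text \<open>
  The sets of allowed weights of a step of given type and height. For \<open>h \<ge> 1\<close> the condition
  \<open>a < h\<close> means \<open>0 \<le> a \<le> h - 1\<close>; for \<open>h = 0\<close> it leaves no weight for
  \<open>H1\<close> and \<open>H2\<close>, while the last equation then gives the weight \<open>p\<close> for \<open>H3\<close>.
\<close>

fun allowed_weights :: "step \<Rightarrow> nat \<Rightarrow> polyn set" where
  "allowed_weights Up h   = {X\<^sub>s * X\<^sub>t ^ (2 * h - 1) * X\<^sub>q ^ a |a. a < h}"
| "allowed_weights Down h = {X\<^sub>q ^ (2 * h - 1 + a) |a. a < h}"
| "allowed_weights H1 h   = {X\<^sub>s * X\<^sub>t ^ h * X\<^sub>q ^ (h + a) |a. a < h}"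
| "allowed_weights H2 h   = {X\<^sub>t ^ h * X\<^sub>q ^ (h + a) |a. a < h}"
| "allowed_weights H3 h   = {X\<^sub>p * X\<^sub>t ^ h * X\<^sub>q ^ (2 * h)}"

definition weighted_paths :: "nat \<Rightarrow> (step \<times> polyn) list set" where
  "weighted_paths n =
     {\<mu>. map fst \<mu> \<in> motzkin_paths n \<and>
         (\<forall>i<n. snd (\<mu> ! i) \<in> allowed_weights (fst (\<mu> ! i)) (step_height (map fst \<mu>) i))}"

definition path_weight :: "(step \<times> polyn) list \<Rightarrow> polyn" where
  "path_weight \<mu> = prod_list (map snd \<mu>)"


section \<open>Jacobi continued fractions\<close>

text \<open>
  \<open>jfrac_convergent gam lam N h\<close> is the part of the continued fraction starting with the
  denominator \<open>1 - gam h z - \<dots>\<close>, truncated after \<open>N\<close> levels. Every denominator has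
  constant coefficient 1, and \<open>fps_left_inverse f 1\<close> is the inverse of such a series over a
  commutative ring that need not be a field.
\<close>

primrec jfrac_convergent ::
    "(nat \<Rightarrow> 'a::comm_ring_1) \<Rightarrow> (nat \<Rightarrow> 'a) \<Rightarrow> nat \<Rightarrow> nat \<Rightarrow> 'a fps" where
  "jfrac_convergent gam lam 0 h = 1"
| "jfrac_convergent gam lam (Suc N) h =
     fps_left_inverse
       (1 - fps_const (gam h) * fps_X
          - fps_const (lam (Suc h)) * fps_X ^ 2 * jfrac_convergent gam lam N (Suc h)) 1"

definition jfrac :: "(nat \<Rightarrow> 'a::comm_ring_1) \<Rightarrow> (nat \<Rightarrow> 'a) \<Rightarrow> 'a fps" where
  "jfrac gam lam = lim (\<lambda>N. jfrac_convergent gam lam N 0)"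

lemma jfrac_convergent_Suc_mult:
  "jfrac_convergent gam lam (Suc N) h *
     (1 - fps_const (gam h) * fps_X
        - fps_const (lam (Suc h)) * fps_X ^ 2 * jfrac_convergent gam lam N (Suc h)) = 1"
  unfolding jfrac_convergent.simps
  by (rule fps_left_inverse) (simp add: fps_mult_nth power2_eq_square)

lemma jfrac_convergent_diff:
  "\<exists>R. jfrac_convergent gam lam (N + k) h - jfrac_convergent gam lam N h = fps_X ^ N * R"
proof (induction N arbitrary: h)
  case 0
  show ?case by auto
next
  case (Suc N)
  obtain R where R: "jfrac_convergent gam lam (N + k) (Suc h) =
      jfrac_convergent gam lam N (Suc h) + fps_X ^ N * R"
    using Suc[of "Suc h"] by (metis add.commute diff_add_cancel)
  define A where "A = jfrac_convergent gam lam (Suc (N + k)) h"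
  define B where "B = jfrac_convergent gam lam (Suc N) h"
  define l where "l = fps_const (lam (Suc h))"
  define a where "a = 1 - fps_const (gam h) * fps_X
     - l * fps_X ^ 2 * jfrac_convergent gam lam (N + k) (Suc h)"
  define b where "b = 1 - fps_const (gam h) * fps_X
     - l * fps_X ^ 2 * jfrac_convergent gam lam N (Suc h)"
  have Aa: "A * a = 1" and Bb: "B * b = 1"
    unfolding A_def B_def a_def b_def l_def by (rule jfrac_convergent_Suc_mult)+
  have ba: "b - a = l * fps_X ^ 2 * (fps_X ^ N * R)"
    unfolding a_def b_def R by (simp add: algebra_simps)
  have "A - B = A * (B * b) - B * (A * a)"
    using Aa Bb by simp
  also have "\<dots> = A * B * (b - a)"
    by (simp add: algebra_simps)
  also have "\<dots> = fps_X ^ Suc N * (A * B * l * fps_X * R)"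
    unfolding ba by (simp add: power2_eq_square algebra_simps)
  finally show ?case
    unfolding A_def B_def add_Suc by blast
qed

lemma jfrac_LIMSEQ: "(\<lambda>N. jfrac_convergent gam lam N 0) \<longlonglongrightarrow> jfrac gam lam"
proof -
  define G where "G = Abs_fps (\<lambda>n. fps_nth (jfrac_convergent gam lam (Suc n) 0) n)"
  have "(\<lambda>N. jfrac_convergent gam lam N 0) \<longlonglongrightarrow> G"
  proof (rule tendsto_fpsI)
    fix n
    show "\<forall>\<^sub>F N in sequentially. fps_nth (jfrac_convergent gam lam N 0) n = fps_nth G n"
      unfolding eventually_sequentially
    proof (intro exI allI impI)
      fix N assume "Suc n \<le> N"
      then obtain k where N: "N = Suc n + k"
        using le_Suc_ex by blast
      obtain R where "jfrac_convergent gam lam N 0 - jfrac_convergent gam lam (Suc n) 0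
          = fps_X ^ Suc n * R"
        using jfrac_convergent_diff[of gam lam "Suc n" k 0] unfolding N by blast
      then have "fps_nth (jfrac_convergent gam lam N 0 - jfrac_convergent gam lam (Suc n) 0) n = 0"
        by (simp only: fps_X_power_mult_nth) simp
      then show "fps_nth (jfrac_convergent gam lam N 0) n = fps_nth G n"
        by (simp add: G_def del: jfrac_convergent.simps)
    qed
  qed
  then show ?thesis
    unfolding jfrac_def by (simp add: limI)
qed

end

theory Submission
  imports Defs
begin

text \<open>
  All weights are monomials, so a weight-preserving bijection exists as soon as both sides have the
  same generating function, and only the latter is compared. For weighted paths from height \<open>h\<close>
  to \<open>0\<close>, splitting off the first step gives a three-term recurrence in \<open>h\<close>.
  For permutations, the restriction of the graph to \<open>{1..n} \<times> {1..n}\<close> is a rook placement with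
  some number \<open>h\<close> of empty rows and equally many empty columns. Passing from \<open>n\<close> to \<open>n + 1\<close> leaves
  row and column \<open>n + 1\<close> both empty (up step), fills one of them or puts a rook on the diagonal
  (horizontal step), or fills both (down step). The inversions which this decides depend only on \<open>h\<close>
  and on the ranks of the chosen row and column, which yields a three-term recurrence as well. The
  up and down coefficients of the two recurrences differ, but the products entering the
  continued fraction do not: such a recurrence determines a Jacobi continued fraction that depends
  on the up and down coefficients only through these products.
\<close>

section \<open>Three-term recurrences and continued fractions\<close>

text \<open>The recurrence is that of weighted paths from height \<open>h\<close> to 0, by first
  step. As \<open>jfrac\<close> is a limit, coefficients are compared with truncations at a level
  \<open>N\<close> beyond all heights that matter.\<close>

lemma jfrac_of_recurrence:
  fixes E :: "nat \<Rightarrow> nat \<Rightarrow> 'a::comm_ring_1"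
  assumes E_0: "\<And>h. E 0 h = of_bool (h = 0)"
    and E_Suc: "\<And>n h. E (Suc n) h =
      gam h * E n h + u h * E n (Suc h) + (if h = 0 then 0 else d h * E n (h - 1))"
    and lam: "\<And>h. lam (Suc h) = u h * d (Suc h)"
  shows "Abs_fps (\<lambda>n. E n 0) = jfrac gam lam"
proof -
  \<comment> \<open>The generating function of \<open>\<lambda>n. E n h\<close> should be \<open>J\<^sub>0 (z d\<^sub>1 J\<^sub>1) \<dots> (z d\<^sub>h J\<^sub>h)\<close>, where
    \<open>J\<^sub>i\<close> is the \<open>i\<close>-th tail of the continued fraction; \<open>F N h\<close> truncates it.\<close>
  define F where "F N = rec_nat (jfrac_convergent gam lam N 0)
    (\<lambda>h f. jfrac_convergent gam lam (N - Suc h) (Suc h) * (fps_X * fps_const (d (Suc h)) * f))" for N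
  define B where "B N h = (if h = 0 then 1 else fps_X * fps_const (d h) * F N (h - 1))" for N h
  have F_B: "F N h = jfrac_convergent gam lam (N - h) h * B N h" for N h
    by (cases h) (simp_all add: F_def B_def)
  \<comment> \<open>Multiplying by the denominator of the \<open>h\<close>-th tail turns
    \<open>F N h\<close> into \<open>B N h\<close>. At \<open>h = N\<close> the tail is cut off to
    1, hence the bound.\<close>
  have F_eq: "F N h = of_bool (h = 0) + fps_X * (fps_const (gam h) * F N h
      + fps_const (u h) * F N (Suc h) + (if h = 0 then 0 else fps_const (d h) * F N (h - 1)))"
    if "h < N" for N h
  proof -
    define J where "J = jfrac_convergent gam lam (N - h) h"
    define K where "K = jfrac_convergent gam lam (N - Suc h) (Suc h)"
    have "J * (1 - fps_const (gam h) * fps_X - fps_const (lam (Suc h)) * fps_X ^ 2 * K) = 1"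
      using jfrac_convergent_Suc_mult[of gam lam "N - Suc h" h] that
      unfolding J_def K_def by (simp only: Suc_diff_Suc)
    then have "F N h * (1 - fps_const (gam h) * fps_X - fps_const (lam (Suc h)) * fps_X ^ 2 * K)
        = B N h"
      unfolding F_B[of N h] J_def[symmetric] by (metis mult.commute mult.left_commute mult_1_left)
    moreover have "F N (Suc h) = K * (fps_X * fps_const (d (Suc h)) * F N h)"
      by (simp add: F_def K_def)
    ultimately show ?thesis
      by (auto simp: B_def lam power2_eq_square algebra_simps simp flip: fps_const_mult)
  qed
  \<comment> \<open>Passing to \<open>Suc h\<close> lowers \<open>n\<close> by one, so
    \<open>n + h\<close> never grows and \<open>h < N\<close> persists.\<close>
  have "fps_nth (F N h) n = E n h" if "n + h < N" for N n h
    using that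
  proof (induction n arbitrary: h)
    case 0
    then show ?case by (subst F_eq) (auto simp: E_0)
  next
    case (Suc n)
    then show ?case by (subst F_eq) (auto simp: E_Suc)
  qed
  from this[of _ 0] have coeff: "fps_nth (jfrac_convergent gam lam N 0) n = E n 0" if "n < N" for N n
    using that by (simp add: F_def)
  have "(\<lambda>N. jfrac_convergent gam lam N 0) \<longlonglongrightarrow> Abs_fps (\<lambda>n. E n 0)"
  proof (rule tendsto_fpsI)
    show "\<forall>\<^sub>F N in sequentially. fps_nth (jfrac_convergent gam lam N 0) n
        = fps_nth (Abs_fps (\<lambda>n. E n 0)) n" for n
      using eventually_gt_at_top[of n] by eventually_elim (simp add: coeff)
  qed
  then show ?thesis
    using jfrac_LIMSEQ LIMSEQ_unique by blast
qed

section \<open>Monomials\<close>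

definition monomials :: "polyn set" where
  "monomials = range (\<lambda>m. Poly_Mapping.single m 1)"

lemma indet_power: "indet x ^ k = Poly_Mapping.single (Poly_Mapping.single x k) 1"
  by (induction k) (simp_all add: indet_def mult_single single_add[symmetric] flip: single_one)

lemma one_in_monomials [simp]: "1 \<in> monomials"
  unfolding monomials_def by (metis single_one rangeI)

lemma indet_power_in_monomials [simp]: "indet x ^ k \<in> monomials"
  by (auto simp: monomials_def indet_power)

lemma indet_in_monomials [simp]: "indet x \<in> monomials"
  by (auto simp: monomials_def indet_def)

lemma mult_in_monomials [simp]: "a \<in> monomials \<Longrightarrow> b \<in> monomials \<Longrightarrow> a * b \<in> monomials"
  by (auto simp: monomials_def mult_single)

lemma monomial_times_power_inject:
  assumes "a \<in> monomials"
  shows "a * indet x ^ i = a * indet x ^ j \<longleftrightarrow> i = j"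
proof -
  obtain m where a: "a = Poly_Mapping.single m 1"
    using assms by (auto simp: monomials_def)
  have "i = j" if "m + Poly_Mapping.single x i = m + Poly_Mapping.single x j"
    using that by (metis add_left_cancel lookup_single_eq)
  then show ?thesis
    by (auto simp: a indet_power mult_single frag_of_eq)
qed

text \<open>All coefficients are 1 and live in the integers, so nothing cancels and the sum
  remembers the size of every fibre.\<close>

lemma lookup_sum_monomials:
  assumes "finite S" "w ` S \<subseteq> monomials"
  shows "Poly_Mapping.lookup (\<Sum>x\<in>S. w x) m
    = int (card {x \<in> S. w x = Poly_Mapping.single m 1})"
proof -
  have "Poly_Mapping.lookup (w x) m = of_bool (w x = Poly_Mapping.single m 1)" if x: "x \<in> S" for x
  proof -
    obtain k where "w x = Poly_Mapping.single k 1"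
      using assms(2) x by (auto simp: monomials_def)
    then show ?thesis
      by (simp add: frag_of_eq lookup_single when_def)
  qed
  then show ?thesis
    using assms(1) by (simp add: lookup_sum Int_def)
qed

section \<open>Weight-preserving bijections from equal sums\<close>

lemma bij_betw_of_card_fibres:
  assumes "finite S" "finite T"
    and fibres: "\<And>c. card {x \<in> S. u x = c} = card {y \<in> T. v y = c}"
  shows "\<exists>f. bij_betw f S T \<and> (\<forall>x\<in>S. v (f x) = u x)"
proof -
  have "\<exists>f. bij_betw f {x \<in> S. u x = c} {y \<in> T. v y = c}" for c
    using assms by (intro finite_same_card_bij) auto
  then obtain f where f: "\<And>c. bij_betw (f c) {x \<in> S. u x = c} {y \<in> T. v y = c}"
    by metis
  have f_in: "f (u x) x \<in> T" "v (f (u x) x) = u x" if "x \<in> S" for x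
    using bij_betwE[OF f[of "u x"]] that by auto
  \<comment> \<open>Each \<open>x\<close> is sent by the bijection chosen for its own fibre.\<close>
  have "bij_betw (\<lambda>x. f (u x) x) S T"
    unfolding bij_betw_def
  proof (intro conjI inj_onI subset_antisym subsetI)
    fix x y assume "x \<in> S" "y \<in> S" "f (u x) x = f (u y) y"
    then have "u x = u y" using f_in(2) by metis
    then show "x = y"
      using \<open>x \<in> S\<close> \<open>y \<in> S\<close> \<open>f (u x) x = f (u y) y\<close>
        inj_onD[OF bij_betw_imp_inj_on[OF f[of "u y"]], of x y] by simp
  next
    fix y assume "y \<in> T"
    then obtain x where "x \<in> S" "u x = v y" "f (v y) x = y"
      using bij_betw_imp_surj_on[OF f[of "v y"]] by force
    then show "y \<in> (\<lambda>x. f (u x) x) ` S" by force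
  qed (use f_in in auto)
  then show ?thesis using f_in by blast
qed

text \<open>Comparing coefficients matches the fibres over monomials; all other fibres are
  empty.\<close>

lemma bij_betw_of_sum_monomials:
  assumes fin: "finite S" "finite T" and mon: "u ` S \<subseteq> monomials" "v ` T \<subseteq> monomials"
    and "sum u S = sum v T"
  shows "\<exists>f. bij_betw f S T \<and> (\<forall>x\<in>S. v (f x) = u x)"
proof (rule bij_betw_of_card_fibres[OF fin])
  fix c
  show "card {x \<in> S. u x = c} = card {y \<in> T. v y = c}"
  proof (cases "c \<in> monomials")
    case True
    then obtain m where c: "c = Poly_Mapping.single m 1"
      by (auto simp: monomials_def)
    have "int (card {x \<in> S. u x = c}) = int (card {y \<in> T. v y = c})"
      unfolding c using assms by (simp flip: lookup_sum_monomials)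
    then show ?thesis by simp
  next
    case False
    then have "{x \<in> S. u x = c} = {}" "{y \<in> T. v y = c} = {}"
      using mon by auto
    then show ?thesis by (simp only: card.empty)
  qed
qed

section \<open>The generating function of weighted paths\<close>

text \<open>Deleting the first step changes the starting height, so induction needs it arbitrary.
  \<open>altitude\<close> still starts at 0, and \<open>h\<close> is added to it.\<close>

definition wpaths_from :: "nat \<Rightarrow> nat \<Rightarrow> (step \<times> polyn) list set" where
  "wpaths_from n h = {\<mu>. length \<mu> = n \<and>
     (\<forall>i\<le>n. 0 \<le> int h + altitude (map fst \<mu>) i) \<and> int h + altitude (map fst \<mu>) n = 0 \<and>
     (\<forall>i<n. snd (\<mu> ! i) \<in> allowed_weights (fst (\<mu> ! i))
        (nat (int h + max (altitude (map fst \<mu>) i) (altitude (map fst \<mu>) (Suc i)))))}"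

lemma weighted_paths_eq: "weighted_paths n = wpaths_from n 0"
  by (auto simp: weighted_paths_def motzkin_paths_def wpaths_from_def step_height_def)

lemma wpaths_from_0: "wpaths_from 0 h = (if h = 0 then {[]} else {})"
  by (auto simp: wpaths_from_def altitude_def)

lemma altitude_0 [simp]: "altitude w 0 = 0"
  by (simp add: altitude_def)

lemma altitude_Cons: "altitude (x # w) (Suc i) = rise x + altitude w i"
  by (simp add: altitude_def sum.lessThan_Suc_shift del: sum.lessThan_Suc)

lemma Cons_in_wpaths_from:
  "(x, \<omega>) # \<mu> \<in> wpaths_from (Suc n) h \<longleftrightarrow>
     0 \<le> int h + rise x \<and> \<omega> \<in> allowed_weights x (nat (int h + max 0 (rise x))) \<and>
     \<mu> \<in> wpaths_from n (nat (int h + rise x))"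
proof (cases "0 \<le> int h + rise x")
  case True
  have "nat (int h + max (rise x + a) (rise x + b)) = nat (int h + rise x + max a b)" for a b
    by (simp add: max_add_distrib_right add.assoc)
  moreover have "(\<forall>i\<le>Suc n. P i) \<longleftrightarrow> P 0 \<and> (\<forall>i\<le>n. P (Suc i))" for P
    using All_less_Suc2[of "Suc n" P] by (simp add: less_Suc_eq_le)
  ultimately show ?thesis
    using True by (simp add: wpaths_from_def altitude_Cons All_less_Suc2 add.assoc) blast
next
  case False
  then show ?thesis
    by (auto simp: wpaths_from_def altitude_Cons intro!: exI[of _ "Suc 0"])
qed

lemma wpaths_from_Suc:
  "wpaths_from (Suc n) h = (\<Union>x\<in>{x. 0 \<le> int h + rise x}.
     (\<lambda>(\<omega>, \<mu>). (x, \<omega>) # \<mu>) ` (allowed_weights x (nat (int h + max 0 (rise x))) \<times>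
       wpaths_from n (nat (int h + rise x))))"
proof -
  have "\<mu> \<in> wpaths_from (Suc n) h \<longleftrightarrow> (\<exists>x \<omega> \<mu>'. \<mu> = (x, \<omega>) # \<mu>' \<and> 0 \<le> int h + rise x \<and>
      \<omega> \<in> allowed_weights x (nat (int h + max 0 (rise x))) \<and>
      \<mu>' \<in> wpaths_from n (nat (int h + rise x)))" for \<mu>
  proof (cases \<mu>)
    case Nil
    then show ?thesis by (simp add: wpaths_from_def)
  next
    case (Cons y \<mu>')
    then show ?thesis by (cases y) (simp add: Cons_in_wpaths_from)
  qed
  then show ?thesis by fastforce
qed

lemma UNIV_step: "(UNIV :: step set) = {Up, Down, H1, H2, H3}"
  using step.exhaust by auto

lemma finite_steps [simp]: "finite (A :: step set)"
  by (rule finite_subset[OF subset_UNIV]) (simp add: UNIV_step)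

lemma finite_allowed_weights: "finite (allowed_weights x h)"
  by (cases x) simp_all

lemma allowed_weights_monomials: "allowed_weights x h \<subseteq> monomials"
  by (cases x) auto

lemma finite_wpaths_from: "finite (wpaths_from n h)"
proof (induction n arbitrary: h)
  case (Suc n)
  show ?case
    unfolding wpaths_from_Suc by (intro finite_UN_I finite_imageI finite_cartesian_product
      finite_allowed_weights Suc.IH finite_steps)
qed (simp add: wpaths_from_0)

lemma path_weight_monomials: "\<mu> \<in> wpaths_from n h \<Longrightarrow> path_weight \<mu> \<in> monomials"
proof (induction n arbitrary: h \<mu>)
  case 0
  then show ?case by (auto simp: wpaths_from_0 path_weight_def split: if_splits)
next
  case (Suc n)
  then show ?case
    using allowed_weights_monomials[THEN subsetD]
    by (auto simp: wpaths_from_Suc path_weight_def intro!: mult_in_monomials)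
qed

definition path_gf :: "nat \<Rightarrow> nat \<Rightarrow> polyn" where
  "path_gf n h = (\<Sum>\<mu>\<in>wpaths_from n h. path_weight \<mu>)"

lemma path_gf_step:
  "path_gf (Suc n) h = (\<Sum>x | 0 \<le> int h + rise x.
     \<Sum>(allowed_weights x (nat (int h + max 0 (rise x)))) * path_gf n (nat (int h + rise x)))"
  unfolding path_gf_def wpaths_from_Suc
  using finite_allowed_weights finite_wpaths_from
  by (subst sum.UNION_disjoint)
    (auto simp: sum.reindex inj_on_def sum_product sum.cartesian_product path_weight_def
      intro!: sum.cong)

text \<open>A sum over a set counts equal weights once; nothing is lost because distinct exponents
  give distinct monomials.\<close>

lemma sum_power_family:
  assumes "a \<in> monomials"
  shows "\<Sum>{a * X\<^sub>q ^ i |i. i < h} = a * q_int h"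
proof -
  have "{a * X\<^sub>q ^ i |i. i < h} = (\<lambda>i. a * X\<^sub>q ^ i) ` {..<h}" by auto
  moreover have "inj_on (\<lambda>i. a * X\<^sub>q ^ i) {..<h}"
    by (simp add: inj_on_def monomial_times_power_inject assms)
  ultimately show ?thesis
    by (simp add: sum.reindex q_int_def sum_distrib_left)
qed

lemma sum_allowed_weights:
  "\<Sum>(allowed_weights Up h) = X\<^sub>s * X\<^sub>t ^ (2 * h - 1) * q_int h"
  "\<Sum>(allowed_weights Down h) = X\<^sub>q ^ (2 * h - 1) * q_int h"
  "\<Sum>(allowed_weights H1 h) = X\<^sub>s * X\<^sub>t ^ h * X\<^sub>q ^ h * q_int h"
  "\<Sum>(allowed_weights H2 h) = X\<^sub>t ^ h * X\<^sub>q ^ h * q_int h"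
  "\<Sum>(allowed_weights H3 h) = X\<^sub>p * X\<^sub>t ^ h * X\<^sub>q ^ (2 * h)"
  using sum_power_family[of "X\<^sub>s * X\<^sub>t ^ (2 * h - 1)" h] sum_power_family[of "X\<^sub>q ^ (2 * h - 1)" h]
    sum_power_family[of "X\<^sub>s * X\<^sub>t ^ h * X\<^sub>q ^ h" h] sum_power_family[of "X\<^sub>t ^ h * X\<^sub>q ^ h" h]
  by (simp_all add: power_add mult.assoc)

abbreviation (input) gam :: "nat \<Rightarrow> polyn" where
  "gam h \<equiv> ((1 + X\<^sub>s) * q_int h + X\<^sub>p * X\<^sub>q ^ h) * (X\<^sub>q * X\<^sub>t) ^ h"

abbreviation (input) lam :: "nat \<Rightarrow> polyn" where
  "lam h \<equiv> X\<^sub>s * q_int h ^ 2 * (X\<^sub>q * X\<^sub>t) ^ (2 * h - 1)"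

text \<open>The three kinds of horizontal step add up to \<open>gam h\<close>. An up step leaving
  height \<open>h\<close> has height \<open>h + 1\<close>, hence the exponent
  \<open>2 * h + 1\<close>; a down step leaving it has height \<open>h\<close>.\<close>

lemma path_gf_Suc:
  "path_gf (Suc n) h = gam h * path_gf n h
     + X\<^sub>s * X\<^sub>t ^ (2 * h + 1) * q_int (Suc h) * path_gf n (Suc h)
     + (if h = 0 then 0 else X\<^sub>q ^ (2 * h - 1) * q_int h * path_gf n (h - 1))"
proof -
  have steps: "{x. 0 \<le> int h + rise x} = (if h = 0 then {} else {Down}) \<union> {Up, H1, H2, H3}"
  proof (intro set_eqI)
    fix x
    show "x \<in> {x. 0 \<le> int h + rise x} \<longleftrightarrow> x \<in> (if h = 0 then {} else {Down}) \<union> {Up, H1, H2, H3}"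
      by (cases x) auto
  qed
  have "nat (int h + 1) = Suc h" "nat (int h - 1) = h - 1"
    by auto
  then show ?thesis
    unfolding path_gf_step steps
    by (simp add: sum_allowed_weights del: allowed_weights.simps)
      (simp add: q_int_def algebra_simps power_mult_distrib mult_2 mult_2_right power_add)
qed

lemma path_gf_jfrac: "Abs_fps (\<lambda>n. path_gf n 0) = jfrac gam lam"
  by (rule jfrac_of_recurrence[where E = path_gf and u = "\<lambda>h. X\<^sub>s * X\<^sub>t ^ (2 * h + 1) * q_int (Suc h)"
        and d = "\<lambda>h. X\<^sub>q ^ (2 * h - 1) * q_int h", OF _ path_gf_Suc])
    (simp_all add: path_gf_def wpaths_from_0 path_weight_def power2_eq_square power_mult_distrib
      algebra_simps)

section \<open>Rook placements\<close>

text \<open>A rook placement on the board \<open>{1..m} \<times> {1..n}\<close> is the part of the graph of a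
  permutation inside that board.\<close>

definition rooks :: "nat \<Rightarrow> nat \<Rightarrow> (nat \<times> nat) set set" where
  "rooks m n = {R. R \<subseteq> {1..m} \<times> {1..n} \<and> inj_on fst R \<and> inj_on snd R}"

definition open_rows :: "nat \<Rightarrow> (nat \<times> nat) set \<Rightarrow> nat set" where
  "open_rows m R = {1..m} - fst ` R"

definition open_cols :: "nat \<Rightarrow> (nat \<times> nat) set \<Rightarrow> nat set" where
  "open_cols n R = {1..n} - snd ` R"

lemma finite_rooks: "finite (rooks m n)"
  by (rule finite_subset[of _ "Pow ({1..m} \<times> {1..n})"]) (auto simp: rooks_def)

lemma finite_rook: "R \<in> rooks m n \<Longrightarrow> finite R"
  by (auto simp: rooks_def intro: finite_subset)

lemma finite_open [simp]: "finite (open_rows m R)" "finite (open_cols n R)"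
  by (simp_all add: open_rows_def open_cols_def)

lemma converse_eq_swap: "R\<inverse> = prod.swap ` R"
  by force

lemma inj_on_converse: "inj_on fst (R\<inverse>) \<longleftrightarrow> inj_on snd R" "inj_on snd (R\<inverse>) \<longleftrightarrow> inj_on fst R"
  by (simp_all add: converse_eq_swap inj_on_def prod_eq_iff conj_commute)

text \<open>Transposition carries facts about rows over to columns and back.\<close>

lemma converse_in_rooks: "R\<inverse> \<in> rooks n m \<longleftrightarrow> R \<in> rooks m n"
  unfolding rooks_def mem_Collect_eq inj_on_converse by auto

lemma open_converse: "open_rows m (R\<inverse>) = open_cols m R" "open_cols m (R\<inverse>) = open_rows m R"
  by (force simp: open_rows_def open_cols_def)+

lemma rooks_converse: "rooks n m = converse ` rooks m n"
  by (auto simp: converse_in_rooks intro!: image_eqI[of _ _ "_\<inverse>"])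

lemma rooks_0: "rooks 0 0 = {{}}"
  by (auto simp: rooks_def)

lemma card_open_rows: "R \<in> rooks m n \<Longrightarrow> card (open_rows m R) = m - card R"
  unfolding open_rows_def by (subst card_Diff_subset) (auto simp: rooks_def card_image finite_rook)

lemma card_open_cols: "R \<in> rooks m n \<Longrightarrow> card (open_cols n R) = n - card R"
  using card_open_rows[of "R\<inverse>" n m]
  by (simp add: converse_in_rooks open_converse)

section \<open>Splitting off the last column or row\<close>

lemma rooks_Suc_col:
  "rooks m (Suc n) = rooks m n \<union>
     (\<lambda>(R, i). insert (i, Suc n) R) ` (SIGMA R:rooks m n. open_rows m R)"
proof (intro subset_antisym subsetI)
  fix R assume R: "R \<in> rooks m (Suc n)"
  show "R \<in> rooks m n \<union> (\<lambda>(R, i). insert (i, Suc n) R) ` (SIGMA R:rooks m n. open_rows m R)"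
  proof (cases "Suc n \<in> snd ` R")
    case False
    then have "R \<in> rooks m n"
      using R by (force simp: rooks_def le_Suc_eq)
    then show ?thesis by simp
  next
    case True
    then obtain i where i: "(i, Suc n) \<in> R" by auto
    \<comment> \<open>Column \<open>Suc n\<close> holds only this rook; without it the placement
      fits into \<open>n\<close> columns and row \<open>i\<close> is empty.\<close>
    define R' where "R' = R - {(i, Suc n)}"
    have sub: "R \<subseteq> {1..m} \<times> {1..Suc n}" and inj: "inj_on fst R" "inj_on snd R"
      using R by (auto simp: rooks_def)
    have "x \<in> {1..m} \<times> {1..n}" if "x \<in> R'" for x
    proof -
      have x: "x \<in> R" "x \<noteq> (i, Suc n)"
        using that by (auto simp: R'_def)
      then have "snd x \<noteq> Suc n"
        using inj_onD[OF inj(2), of x "(i, Suc n)"] i by auto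
      then show ?thesis
        using subsetD[OF sub x(1)] by (cases x) auto
    qed
    moreover have "inj_on fst R'" "inj_on snd R'"
      using inj by (auto simp: R'_def intro: inj_on_subset)
    ultimately have "R' \<in> rooks m n"
      by (auto simp: rooks_def)
    moreover have "i \<in> open_rows m R'"
    proof -
      have "fst x \<noteq> i" if "x \<in> R'" for x
        using that i inj_onD[OF inj(1), of x "(i, Suc n)"] by (auto simp: R'_def)
      then show ?thesis
        using subsetD[OF sub i] by (auto simp: open_rows_def)
    qed
    moreover have "R = insert (i, Suc n) R'"
      using i by (auto simp: R'_def)
    ultimately show ?thesis by force
  qed
next
  fix R assume "R \<in> rooks m n \<union> (\<lambda>(R, i). insert (i, Suc n) R) ` (SIGMA R:rooks m n. open_rows m R)"
  then consider "R \<in> rooks m n"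
    | i R' where "R' \<in> rooks m n" "i \<in> open_rows m R'" "R = insert (i, Suc n) R'"
    by auto
  then show "R \<in> rooks m (Suc n)"
  proof cases
    case 1
    then show ?thesis by (auto simp: rooks_def)
  next
    case 2
    then have "Suc n \<notin> snd ` R'" "i \<notin> fst ` R'" "i \<in> {1..m}"
      by (auto simp: rooks_def open_rows_def)
    with 2 show ?thesis
      by (auto simp: rooks_def)
  qed
qed

text \<open>The rook in column \<open>Suc n\<close>, if any, can be read off the enlarged placement,
  so each placement arises just once.\<close>

lemma sum_rooks_Suc_col:
  fixes g :: "(nat \<times> nat) set \<Rightarrow> 'a::comm_monoid_add"
  shows "(\<Sum>R\<in>rooks m (Suc n). g R) =
    (\<Sum>R\<in>rooks m n. g R + (\<Sum>i\<in>open_rows m R. g (insert (i, Suc n) R)))"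
proof -
  have fresh: "(j, Suc n) \<notin> R" if "R \<in> rooks m n" for R j
    using that by (auto simp: rooks_def)
  have inj: "inj_on (\<lambda>(R, i). insert (i, Suc n) R) (SIGMA R:rooks m n. open_rows m R)"
  proof (rule inj_onI, clarsimp)
    fix R i R' i'
    assume R: "R \<in> rooks m n" "R' \<in> rooks m n" and eq: "insert (i, Suc n) R = insert (i', Suc n) R'"
    have "i = i'"
      using eq fresh[OF R(1)] fresh[OF R(2)] by (metis insertE insertI1 prod.inject)
    then show "R = R' \<and> i = i'"
      using eq fresh[OF R(1)] fresh[OF R(2)] by (metis insert_ident)
  qed
  show ?thesis
    unfolding rooks_Suc_col
  proof (subst sum.union_disjoint)
    show "rooks m n \<inter> (\<lambda>(R, i). insert (i, Suc n) R) ` (SIGMA R:rooks m n. open_rows m R) = {}"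
      using fresh by auto
  qed (simp_all add: finite_rooks sum.reindex[OF inj[unfolded split_def]]
      sum.Sigma sum.distrib split_def)
qed

lemma sum_rooks_Suc_row:
  fixes g :: "(nat \<times> nat) set \<Rightarrow> 'a::comm_monoid_add"
  shows "(\<Sum>R\<in>rooks (Suc m) n. g R) =
    (\<Sum>R\<in>rooks m n. g R + (\<Sum>v\<in>open_cols n R. g (insert (Suc m, v) R)))"
proof -
  have inj: "inj_on converse A" for A :: "(nat \<times> nat) set set"
    by (auto simp: inj_on_def)
  have "converse (insert (v, Suc m) R) = insert (Suc m, v) (R\<inverse>)" for v and R :: "(nat \<times> nat) set"
    by auto
  then show ?thesis
    unfolding rooks_converse[of _ n] sum.reindex[OF inj] o_def sum_rooks_Suc_col
    by (simp add: open_converse)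
qed

subsection \<open>Statistics\<close>

text \<open>Here \<open>A\<close> and \<open>B\<close> are the empty rows and columns. In a completion to a permutation, an
  empty row receives a column beyond \<open>n\<close> and an empty column a row beyond \<open>m\<close>, so exactly the
  inversions counted below are already decided, among them all pairs in \<open>A \<times> B\<close>.\<close>

definition rook_inv :: "(nat \<times> nat) set \<Rightarrow> nat set \<Rightarrow> nat set \<Rightarrow> nat" where
  "rook_inv R A B = (\<Sum>x\<in>R. \<Sum>y\<in>R. of_bool (fst x < fst y \<and> snd y < snd x))
     + (\<Sum>i\<in>A. \<Sum>y\<in>R. of_bool (i < fst y)) + (\<Sum>v\<in>B. \<Sum>x\<in>R. of_bool (v < snd x))
     + card A * card B"

lemma rook_inv_converse: "rook_inv (R\<inverse>) B A = rook_inv R A B"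
proof -
  have "(\<Sum>x\<in>R. \<Sum>y\<in>R. of_bool (snd x < snd y \<and> fst y < fst x)) =
      (\<Sum>x\<in>R. \<Sum>y\<in>R. of_bool (fst x < fst y \<and> snd y < snd x) :: nat)"
    by (subst sum.swap) (simp add: conj_commute)
  then show ?thesis
    by (simp add: rook_inv_def converse_eq_swap sum.reindex)
qed

text \<open>An empty column to the right of all rooks has no decided inversion with a rook, but one
  with each empty row.\<close>

lemma rook_inv_open_col:
  assumes "finite B" "n \<notin> B" "\<And>x. x \<in> R \<Longrightarrow> snd x < n"
  shows "rook_inv R A (insert n B) = rook_inv R A B + card A"
proof -
  have "(\<Sum>x\<in>R. of_bool (n < snd x)) = (0 :: nat)"
    by (rule sum.neutral) (use assms(3) in force)
  then show ?thesis
    using assms(1,2) by (simp add: rook_inv_def)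
qed

definition rank :: "nat set \<Rightarrow> nat \<Rightarrow> nat" where
  "rank A i = card {j \<in> A. j < i}"

text \<open>The new rook takes over the inversions counted for the empty row \<open>i\<close>: those
  with rooks in later rows and with the empty columns. New are those with the
  \<open>rank A i\<close> empty rows before it, which receive columns beyond
  \<open>n\<close>.\<close>

lemma rook_inv_insert:
  assumes fin: "finite R" "finite A" "finite B" and i: "i \<in> A"
    and R: "\<And>x. x \<in> R \<Longrightarrow> snd x < n" and B: "\<And>v. v \<in> B \<Longrightarrow> v < n"
  shows "rook_inv (insert (i, n) R) (A - {i}) B = rook_inv R A B + rank A i"
proof -
  obtain A' where A: "A = insert i A'" "i \<notin> A'" "finite A'"
    using i fin(2) by (metis finite_insert mk_disjoint_insert)
  have notin: "(i, n) \<notin> R"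
    using R by force
  have "(\<Sum>x\<in>R. of_bool (fst x < i \<and> n < snd x)) = (0 :: nat)"
    by (rule sum.neutral) (use R in force)
  moreover have "(\<Sum>x\<in>R. of_bool (i < fst x \<and> snd x < n)) = (\<Sum>x\<in>R. of_bool (i < fst x) :: nat)"
    by (rule sum.cong) (use R in auto)
  moreover have "(\<Sum>v\<in>B. of_bool (v < n)) = card B"
    using B by simp
  moreover have "rank A i = (\<Sum>j\<in>A'. of_bool (j < i))"
  proof -
    have "{j \<in> A. j < i} = A' \<inter> {j. j < i}"
      using A by auto
    then show ?thesis using A by (simp add: rank_def)
  qed
  ultimately show ?thesis
    using A fin notin by (simp add: rook_inv_def sum.distrib del: sum_of_bool_eq)
qed

text \<open>On \<open>A\<close>, \<open>rank\<close> is a bijection onto \<open>{..<card A}\<close>: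
  a new maximum gets rank \<open>card A\<close> and the other ranks stay. This is the source of the
  q-integers.\<close>

lemma sum_rank:
  fixes f :: "nat \<Rightarrow> 'a::comm_monoid_add"
  assumes "finite A"
  shows "(\<Sum>i\<in>A. f (rank A i)) = (\<Sum>k<card A. f k)"
  using assms
proof (induction A rule: finite_linorder_max_induct)
  case (insert b A)
  have "rank (insert b A) b = card A"
    using insert.hyps by (auto simp: rank_def intro!: arg_cong[of _ _ card])
  moreover have "rank (insert b A) i = rank A i" if "i \<in> A" for i
    using insert.hyps that by (auto simp: rank_def intro!: arg_cong[of _ _ card])
  moreover have "b \<notin> A" using insert.hyps by blast
  ultimately show ?case
    using insert by (simp add: add.commute)
qed simp

lemma sum_power_rank: "finite A \<Longrightarrow> (\<Sum>i\<in>A. X\<^sub>q ^ rank A i) = q_int (card A)"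
  by (simp add: sum_rank[of _ "\<lambda>k. X\<^sub>q ^ k"] q_int_def)

lemma rook_inv_open_row:
  assumes "finite A" "n \<notin> A" "\<And>x. x \<in> R \<Longrightarrow> fst x < n"
  shows "rook_inv R (insert n A) B = rook_inv R A B + card B"
  using rook_inv_open_col[of A n "R\<inverse>" B] assms by (auto simp: rook_inv_converse)

lemma rook_inv_insert_row:
  assumes "finite R" "finite A" "finite B" "v \<in> B"
    and "\<And>x. x \<in> R \<Longrightarrow> fst x < n" "\<And>i. i \<in> A \<Longrightarrow> i < n"
  shows "rook_inv (insert (n, v) R) A (B - {v}) = rook_inv R A B + rank B v"
proof -
  have "rook_inv ((insert (n, v) R)\<inverse>) (B - {v}) A = rook_inv (R\<inverse>) B A + rank B v"
  proof -
    have "(insert (n, v) R)\<inverse> = insert (v, n) (R\<inverse>)" by auto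
    then show ?thesis
      using rook_inv_insert[of "R\<inverse>" B A v n] assms by auto
  qed
  then show ?thesis by (simp only: rook_inv_converse)
qed

section \<open>Fixed points, excedances, depth and the weight of a placement\<close>

definition rook_fix :: "(nat \<times> nat) set \<Rightarrow> nat" where
  "rook_fix R = card {x \<in> R. fst x = snd x}"

text \<open>An empty row \<open>i \<le> n\<close> is bound to become an excedance, and its contribution to the depth up to
  column \<open>n\<close> is \<open>n - i\<close>; in an intermediate board with \<open>n + 1\<close> rows, row \<open>n + 1\<close> may be empty but
  contributes nothing.\<close>

definition rook_exc :: "nat \<Rightarrow> (nat \<times> nat) set \<Rightarrow> nat set \<Rightarrow> nat" where
  "rook_exc n R A = card {x \<in> R. fst x < snd x} + card {i \<in> A. i \<le> n}"

definition rook_depth :: "nat \<Rightarrow> (nat \<times> nat) set \<Rightarrow> nat set \<Rightarrow> nat" where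
  "rook_depth n R A = (\<Sum>x\<in>R. snd x - fst x) + (\<Sum>i\<in>A. n - i)"

definition rook_weight :: "nat \<Rightarrow> nat \<Rightarrow> (nat \<times> nat) set \<Rightarrow> polyn" where
  "rook_weight m n R = X\<^sub>q ^ rook_inv R (open_rows m R) (open_cols n R) * X\<^sub>p ^ rook_fix R
     * X\<^sub>s ^ rook_exc n R (open_rows m R) * X\<^sub>t ^ rook_depth n R (open_rows m R)"

lemma rooksD:
  assumes "R \<in> rooks m n" "x \<in> R"
  shows "1 \<le> fst x" "fst x \<le> m" "1 \<le> snd x" "snd x \<le> n"
  using assms by (auto simp: rooks_def)

lemma open_rows_insert [simp]: "open_rows m (insert x R) = open_rows m R - {fst x}"
  by (auto simp: open_rows_def)

lemma open_cols_insert [simp]: "open_cols n (insert x R) = open_cols n R - {snd x}"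
  by (auto simp: open_cols_def)

lemma open_rows_Suc: "R \<in> rooks m n \<Longrightarrow> open_rows (Suc m) R = insert (Suc m) (open_rows m R)"
  by (auto simp: open_rows_def rooks_def le_Suc_eq)

lemma open_cols_Suc: "R \<in> rooks m n \<Longrightarrow> open_cols (Suc n) R = insert (Suc n) (open_cols n R)"
  by (auto simp: open_cols_def rooks_def le_Suc_eq)

lemma Suc_notin_open [simp]: "Suc m \<notin> open_rows m R" "Suc n \<notin> open_cols n R"
  by (auto simp: open_rows_def open_cols_def)

lemma rook_weight_open_row:
  assumes R: "R \<in> rooks n n"
  shows "rook_weight (Suc n) n R = rook_weight n n R * X\<^sub>q ^ card (open_cols n R)"
proof -
  have "rook_inv R (insert (Suc n) (open_rows n R)) (open_cols n R)
      = rook_inv R (open_rows n R) (open_cols n R) + card (open_cols n R)"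
    by (rule rook_inv_open_row) (use rooksD[OF R] in \<open>auto simp: less_Suc_eq_le\<close>)
  moreover have "{i. (i = Suc n \<or> i \<in> open_rows n R) \<and> i \<le> n} = {i \<in> open_rows n R. i \<le> n}"
    by auto
  ultimately show ?thesis
    by (simp add: rook_weight_def open_rows_Suc[OF R] rook_exc_def rook_depth_def power_add
        mult_ac)
qed

lemma rook_weight_insert_row:
  assumes R: "R \<in> rooks n n" and v: "v \<in> open_cols n R"
  shows "rook_weight (Suc n) n (insert (Suc n, v) R) = rook_weight n n R * X\<^sub>q ^ rank (open_cols n R) v"
proof -
  have inv: "rook_inv (insert (Suc n, v) R) (open_rows n R) (open_cols n R - {v})
      = rook_inv R (open_rows n R) (open_cols n R) + rank (open_cols n R) v"
    by (rule rook_inv_insert_row)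
      (use rooksD[OF R] finite_rook[OF R] v in \<open>auto simp: less_Suc_eq_le open_rows_def\<close>)
  have notin: "(Suc n, v) \<notin> R" and v_le: "v \<le> n"
    using rooksD[OF R] v by (force simp: open_cols_def)+
  \<comment> \<open>Since \<open>v \<le> n\<close>, the new rook is neither a fixed point nor an
    excedance, and its truncated difference in the depth is 0.\<close>
  have "{x. (x = (Suc n, v) \<or> x \<in> R) \<and> fst x = snd x} = {x \<in> R. fst x = snd x}"
    "{x. (x = (Suc n, v) \<or> x \<in> R) \<and> fst x < snd x} = {x \<in> R. fst x < snd x}"
    using v_le by auto
  then show ?thesis
    using notin v_le finite_rook[OF R]
    by (simp add: rook_weight_def open_rows_Suc[OF R] inv rook_fix_def rook_exc_def rook_depth_def
        power_add mult_ac)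
qed

text \<open>Column \<open>Suc n\<close> adds one unit for every empty row up to \<open>n\<close>;
  for row \<open>Suc n\<close> both truncated differences are 0.\<close>

lemma rook_depth_Suc:
  assumes "finite A" "A \<subseteq> {..Suc n}"
  shows "rook_depth (Suc n) R A = rook_depth n R A + card (A - {Suc n})"
proof -
  have "(\<Sum>i\<in>A. Suc n - i) = (\<Sum>i\<in>A. (n - i) + of_bool (i \<noteq> Suc n))"
    by (rule sum.cong) (use assms in \<open>auto simp: Suc_diff_le le_Suc_eq\<close>)
  also have "\<dots> = (\<Sum>i\<in>A. n - i) + card (A - {Suc n})"
    using assms by (simp add: sum.distrib Diff_eq Collect_neg_eq[symmetric] Compl_eq)
  finally show ?thesis by (simp add: rook_depth_def)
qed

lemma rook_exc_Suc:
  assumes "finite A" "A \<subseteq> {..Suc n}"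
  shows "rook_exc (Suc n) R A = rook_exc n R A + of_bool (Suc n \<in> A)"
proof -
  have "{i \<in> A. i \<le> Suc n} = {i \<in> A. i \<le> n} \<union> (if Suc n \<in> A then {Suc n} else {})"
    by (auto simp: le_Suc_eq)
  then show ?thesis
    using assms by (simp add: rook_exc_def)
qed

lemma rook_weight_open_col:
  assumes R: "R \<in> rooks (Suc n) n"
  defines "A \<equiv> open_rows (Suc n) R"
  shows "rook_weight (Suc n) (Suc n) R = rook_weight (Suc n) n R * X\<^sub>q ^ card A
    * X\<^sub>s ^ of_bool (Suc n \<in> A) * X\<^sub>t ^ card (A - {Suc n})"
proof -
  have A: "finite A" "A \<subseteq> {..Suc n}"
    by (auto simp: A_def open_rows_def)
  have "rook_inv R A (insert (Suc n) (open_cols n R)) = rook_inv R A (open_cols n R) + card A"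
    by (rule rook_inv_open_col) (use rooksD[OF R] in \<open>auto simp: less_Suc_eq_le\<close>)
  then show ?thesis
    unfolding rook_weight_def A_def[symmetric] open_cols_Suc[OF R]
    by (simp only: rook_depth_Suc[OF A] rook_exc_Suc[OF A] power_add mult_ac)
qed

text \<open>A rook in row \<open>i \<le> n\<close> only fulfils the excedance and depth booked for
  that row while empty. For \<open>i = Suc n\<close> it is a fixed point instead, and row
  \<open>Suc n\<close> no longer becomes an excedance.\<close>

lemma rook_weight_insert_col:
  assumes R: "R \<in> rooks (Suc n) n"
  defines "A \<equiv> open_rows (Suc n) R"
  assumes i: "i \<in> A"
  shows "rook_weight (Suc n) (Suc n) (insert (i, Suc n) R) = rook_weight (Suc n) n R * X\<^sub>q ^ rank A i
    * X\<^sub>p ^ of_bool (i = Suc n) * X\<^sub>s ^ of_bool (Suc n \<in> A \<and> i \<noteq> Suc n) * X\<^sub>t ^ card (A - {Suc n})"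
proof -
  have A: "finite A" "A \<subseteq> {..Suc n}"
    by (auto simp: A_def open_rows_def)
  have fin: "finite R" and notin: "(i, Suc n) \<notin> R" and i_le: "i \<le> Suc n"
    using finite_rook[OF R] rooksD[OF R] A i by force+
  have inv: "rook_inv (insert (i, Suc n) R) (A - {i}) (open_cols n R)
      = rook_inv R A (open_cols n R) + rank A i"
    by (rule rook_inv_insert)
      (use rooksD[OF R] fin A i in \<open>auto simp: less_Suc_eq_le open_cols_def\<close>)
  have "{x. (x = (i, Suc n) \<or> x \<in> R) \<and> fst x = snd x}
      = {x \<in> R. fst x = snd x} \<union> (if i = Suc n then {(i, Suc n)} else {})"
    by auto
  then have fix_eq: "rook_fix (insert (i, Suc n) R) = rook_fix R + of_bool (i = Suc n)"
    using fin notin by (cases "i = Suc n") (simp_all add: rook_fix_def)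
  have "{x. (x = (i, Suc n) \<or> x \<in> R) \<and> fst x < snd x}
      = {x \<in> R. fst x < snd x} \<union> (if i < Suc n then {(i, Suc n)} else {})"
    by auto
  then have "rook_exc (Suc n) (insert (i, Suc n) R) (A - {i})
      = card {x \<in> R. fst x < snd x} + of_bool (i \<noteq> Suc n) + card {j \<in> A - {i}. j \<le> Suc n}"
    using fin notin i_le by (simp add: rook_exc_def)
  moreover have "{j \<in> A. j \<le> Suc n} = insert i {j \<in> A - {i}. j \<le> Suc n}"
    using i i_le by auto
  then have "card {j \<in> A. j \<le> Suc n} = Suc (card {j \<in> A - {i}. j \<le> Suc n})"
    using A by simp
  moreover have "rook_exc (Suc n) R A = card {x \<in> R. fst x < snd x} + card {j \<in> A. j \<le> Suc n}"
    by (simp add: rook_exc_def)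
  ultimately have exc: "rook_exc (Suc n) (insert (i, Suc n) R) (A - {i})
      = rook_exc n R A + of_bool (Suc n \<in> A \<and> i \<noteq> Suc n)"
    using rook_exc_Suc[OF A, of R] i by (auto split: if_splits)
  have "(\<Sum>j\<in>A. Suc n - j) = (Suc n - i) + (\<Sum>j\<in>A - {i}. Suc n - j)"
    using A i by (simp add: sum.remove)
  then have "rook_depth (Suc n) (insert (i, Suc n) R) (A - {i}) = rook_depth (Suc n) R A"
    using fin notin by (simp add: rook_depth_def)
  then have depth: "rook_depth (Suc n) (insert (i, Suc n) R) (A - {i})
      = rook_depth n R A + card (A - {Suc n})"
    using rook_depth_Suc[OF A] by simp
  have "open_cols (Suc n) (insert (i, Suc n) R) = open_cols n R"
    by (simp add: open_cols_Suc[OF R])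
  moreover have "open_rows (Suc n) (insert (i, Suc n) R) = A - {i}"
    by (simp add: A_def)
  ultimately show ?thesis
    unfolding rook_weight_def A_def[symmetric]
    by (simp only: inv fix_eq exc depth power_add mult_ac)
qed

subsection \<open>Adding a column and a row\<close>

text \<open>\<open>f\<close> stands for any quantity depending only on the number of empty rows,
  later the generating function of completions. All options for column \<open>Suc n\<close> share
  the depth factor.\<close>

lemma sum_rooks_Suc_col_weight:
  fixes f :: "nat \<Rightarrow> polyn"
  assumes R: "R \<in> rooks (Suc n) n"
  defines "A \<equiv> open_rows (Suc n) R"
  defines "g \<equiv> \<lambda>R. rook_weight (Suc n) (Suc n) R * f (card (open_rows (Suc n) R))"
  shows "g R + (\<Sum>i\<in>A. g (insert (i, Suc n) R)) = rook_weight (Suc n) n R *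
    X\<^sub>t ^ card (A - {Suc n}) * (X\<^sub>q ^ card A * X\<^sub>s ^ of_bool (Suc n \<in> A) * f (card A) +
      (\<Sum>i\<in>A. X\<^sub>q ^ rank A i * X\<^sub>p ^ of_bool (i = Suc n) * X\<^sub>s ^ of_bool (Suc n \<in> A \<and> i \<noteq> Suc n))
        * f (card A - 1))"
proof -
  have "g (insert (i, Suc n) R) = rook_weight (Suc n) n R * X\<^sub>t ^ card (A - {Suc n}) *
      ((X\<^sub>q ^ rank A i * X\<^sub>p ^ of_bool (i = Suc n) * X\<^sub>s ^ of_bool (Suc n \<in> A \<and> i \<noteq> Suc n))
        * f (card A - 1))" if i: "i \<in> A" for i
    using rook_weight_insert_col[OF R i[unfolded A_def]] i
    by (simp add: g_def A_def mult_ac card_Diff_singleton)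
  moreover have "g R = rook_weight (Suc n) n R * X\<^sub>t ^ card (A - {Suc n}) *
      (X\<^sub>q ^ card A * X\<^sub>s ^ of_bool (Suc n \<in> A) * f (card A))"
    using rook_weight_open_col[OF R] by (simp add: g_def A_def mult_ac)
  ultimately show ?thesis
    by (simp add: sum_distrib_left sum_distrib_right distrib_left)
qed

text \<open>One growth step of the board, as an operator on \<open>f\<close>. The last column is
  split off before the last row, so the intermediate board is \<open>Suc n\<close> by
  \<open>n\<close>.\<close>

lemma sum_rooks_Suc_weight:
  fixes f :: "nat \<Rightarrow> polyn"
  shows "(\<Sum>R\<in>rooks (Suc n) (Suc n). rook_weight (Suc n) (Suc n) R * f (card (open_rows (Suc n) R)))
    = (\<Sum>R\<in>rooks n n. rook_weight n n R * (let h = card (open_rows n R) in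
        gam h * f h + X\<^sub>s * X\<^sub>q ^ (2 * h + 1) * X\<^sub>t ^ h * f (Suc h) + q_int h ^ 2 * X\<^sub>t ^ h * f (h - 1)))"
proof -
  define S where "S R = rook_weight (Suc n) n R *
    X\<^sub>t ^ card (open_rows (Suc n) R - {Suc n}) * (X\<^sub>q ^ card (open_rows (Suc n) R)
      * X\<^sub>s ^ of_bool (Suc n \<in> open_rows (Suc n) R) * f (card (open_rows (Suc n) R)) +
      (\<Sum>i\<in>open_rows (Suc n) R. X\<^sub>q ^ rank (open_rows (Suc n) R) i * X\<^sub>p ^ of_bool (i = Suc n)
        * X\<^sub>s ^ of_bool (Suc n \<in> open_rows (Suc n) R \<and> i \<noteq> Suc n))
        * f (card (open_rows (Suc n) R) - 1))" for R
  have "(\<Sum>R\<in>rooks (Suc n) (Suc n). rook_weight (Suc n) (Suc n) R * f (card (open_rows (Suc n) R)))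
      = (\<Sum>R\<in>rooks (Suc n) n. S R)"
    unfolding sum_rooks_Suc_col S_def by (rule sum.cong[OF refl], rule sum_rooks_Suc_col_weight)
  also have "\<dots> = (\<Sum>R\<in>rooks n n. S R + (\<Sum>v\<in>open_cols n R. S (insert (Suc n, v) R)))"
    by (rule sum_rooks_Suc_row)
  also have "\<dots> = (\<Sum>R\<in>rooks n n. rook_weight n n R * (let h = card (open_rows n R) in
      gam h * f h + X\<^sub>s * X\<^sub>q ^ (2 * h + 1) * X\<^sub>t ^ h * f (Suc h) + q_int h ^ 2 * X\<^sub>t ^ h * f (h - 1)))"
  proof (rule sum.cong[OF refl])
    fix R assume R: "R \<in> rooks n n"
    define A h where "A = open_rows n R" and "h = card A"
    have cols: "card (open_cols n R) = h"
      using card_open_rows[OF R] card_open_cols[OF R] by (simp add: h_def A_def)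
    have A: "finite A" "Suc n \<notin> A" "\<And>i. i \<in> A \<Longrightarrow> i \<le> n"
      by (auto simp: A_def open_rows_def)
    \<comment> \<open>First let row \<open>Suc n\<close> have no rook in columns up to
      \<open>n\<close>. As the last empty row it has rank \<open>h\<close>; a rook there in column
      \<open>Suc n\<close> is a fixed point, otherwise the row becomes an excedance.\<close>
    have "rank (insert (Suc n) A) (Suc n) = h"
      using A by (auto simp: rank_def h_def less_Suc_eq_le intro!: arg_cong[of _ _ card])
    moreover have "rank (insert (Suc n) A) i = rank A i" if "i \<in> A" for i
      using A that by (auto simp: rank_def intro!: arg_cong[of _ _ card]) fastforce
    moreover have "i \<noteq> Suc n" if "i \<in> A" for i
      using A that by auto
    ultimately have "(\<Sum>i\<in>insert (Suc n) A. X\<^sub>q ^ rank (insert (Suc n) A) i * X\<^sub>p ^ of_bool (i = Suc n)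
        * X\<^sub>s ^ of_bool (i \<noteq> Suc n)) = X\<^sub>q ^ h * X\<^sub>p + (\<Sum>i\<in>A. X\<^sub>q ^ rank A i * X\<^sub>s)"
      using A by simp
    also have "\<dots> = X\<^sub>q ^ h * X\<^sub>p + q_int h * X\<^sub>s"
      using A by (simp add: sum_power_rank h_def flip: sum_distrib_right)
    finally have S_open: "S R = rook_weight n n R * X\<^sub>q ^ h * X\<^sub>t ^ h *
        (X\<^sub>q ^ Suc h * X\<^sub>s * f (Suc h) + (X\<^sub>q ^ h * X\<^sub>p + q_int h * X\<^sub>s) * f h)"
      using A(1,2)
      by (simp add: S_def rook_weight_open_row[OF R] open_rows_Suc[OF R] cols A_def[symmetric]
          h_def[symmetric])
    \<comment> \<open>Now row \<open>Suc n\<close> has a rook in a column \<open>v \<le> n\<close>.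
      Ranks in \<open>A\<close> and ranks of \<open>v\<close> contribute one factor
      \<open>q_int h\<close> each.\<close>
    have "(\<Sum>i\<in>A. X\<^sub>q ^ rank A i * X\<^sub>p ^ of_bool (i = Suc n)) = q_int h"
    proof -
      have "X\<^sub>q ^ rank A i * X\<^sub>p ^ of_bool (i = Suc n) = X\<^sub>q ^ rank A i" if "i \<in> A" for i
        using A that by auto
      then show ?thesis
        using sum_power_rank[OF A(1)] by (simp add: h_def)
    qed
    then have S_insert: "S (insert (Suc n, v) R) = X\<^sub>q ^ rank (open_cols n R) v *
        (rook_weight n n R * X\<^sub>t ^ h * (X\<^sub>q ^ h * f h + q_int h * f (h - 1)))"
      if "v \<in> open_cols n R" for v
      using A(1,2) that
      by (simp add: S_def rook_weight_insert_row[OF R] open_rows_Suc[OF R] cols A_def[symmetric]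
          h_def[symmetric] mult_ac)
    have "(\<Sum>v\<in>open_cols n R. S (insert (Suc n, v) R)) =
        q_int h * (rook_weight n n R * X\<^sub>t ^ h * (X\<^sub>q ^ h * f h + q_int h * f (h - 1)))"
      by (simp add: S_insert sum_power_rank cols flip: sum_distrib_right)
    then show "S R + (\<Sum>v\<in>open_cols n R. S (insert (Suc n, v) R)) = rook_weight n n R *
        (let h = card (open_rows n R) in gam h * f h + X\<^sub>s * X\<^sub>q ^ (2 * h + 1) * X\<^sub>t ^ h * f (Suc h)
          + q_int h ^ 2 * X\<^sub>t ^ h * f (h - 1))"
      unfolding A_def[symmetric] h_def[symmetric] Let_def S_open
      by (simp add: algebra_simps power2_eq_square power_mult_distrib mult_2 mult_2_right power_add)
  qed
  finally show ?thesis .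
qed

text \<open>The weighted count of completions, in \<open>n\<close> growth steps, of a placement with
  \<open>h\<close> empty rows and \<open>h\<close> empty columns.\<close>

fun perm_gf :: "nat \<Rightarrow> nat \<Rightarrow> polyn" where
  "perm_gf 0 h = of_bool (h = 0)"
| "perm_gf (Suc n) h = gam h * perm_gf n h + X\<^sub>s * X\<^sub>q ^ (2 * h + 1) * X\<^sub>t ^ h * perm_gf n (Suc h)
     + (if h = 0 then 0 else q_int h ^ 2 * X\<^sub>t ^ h * perm_gf n (h - 1))"

text \<open>Unlike for paths, both q-integers sit in the down coefficient and the power of
  \<open>X\<^sub>q\<close> in the up coefficient, but their product is again
  \<open>lam (Suc h)\<close>.\<close>

lemma perm_gf_jfrac: "Abs_fps (\<lambda>n. perm_gf n 0) = jfrac gam lam"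
  by (rule jfrac_of_recurrence[where E = perm_gf
        and u = "\<lambda>h. X\<^sub>s * X\<^sub>q ^ (2 * h + 1) * X\<^sub>t ^ h" and d = "\<lambda>h. q_int h ^ 2 * X\<^sub>t ^ h",
        OF _ perm_gf.simps(2)])
    (simp_all add: power2_eq_square power_mult_distrib algebra_simps mult_2 mult_2_right power_add)

text \<open>\<open>n\<close> growth steps are realised on the board and \<open>k\<close> remain; the
  induction trades one for the other, so \<open>k\<close> must vary.\<close>

lemma sum_rooks_perm_gf:
  "(\<Sum>R\<in>rooks n n. rook_weight n n R * perm_gf k (card (open_rows n R))) = perm_gf (n + k) 0"
proof (induction n arbitrary: k)
  case 0
  show ?case
    by (simp add: rooks_0 rook_weight_def rook_inv_def rook_fix_def rook_exc_def rook_depth_def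
        open_rows_def open_cols_def)
next
  case (Suc n)
  \<comment> \<open>At \<open>i = 0\<close> the last term vanishes because
    \<open>q_int 0 = 0\<close>, in agreement with the \<open>if\<close> in
    \<open>perm_gf\<close>.\<close>
  have "(let h = i in gam h * perm_gf k h + X\<^sub>s * X\<^sub>q ^ (2 * h + 1) * X\<^sub>t ^ h * perm_gf k (Suc h)
      + q_int h ^ 2 * X\<^sub>t ^ h * perm_gf k (h - 1)) = perm_gf (Suc k) i" for i
    by (cases i) (simp_all add: Let_def q_int_def)
  then show ?case
    using Suc.IH[of "Suc k"] by (simp only: sum_rooks_Suc_weight add_Suc_shift)
qed

subsection \<open>Permutations as complete placements\<close>

definition perm_graph :: "nat \<Rightarrow> (nat \<Rightarrow> nat) \<Rightarrow> (nat \<times> nat) set" where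
  "perm_graph n \<sigma> = (\<lambda>i. (i, \<sigma> i)) ` {1..n}"

lemma bij_betw_perm_graph:
  "bij_betw (perm_graph n) (perms n) {R \<in> rooks n n. card (open_rows n R) = 0}"
proof (rule bij_betw_imageI)
  show "inj_on (perm_graph n) (perms n)"
  proof (rule inj_onI, rule ext)
    fix \<sigma> \<tau> i assume perms: "\<sigma> \<in> perms n" "\<tau> \<in> perms n" and eq: "perm_graph n \<sigma> = perm_graph n \<tau>"
    show "\<sigma> i = \<tau> i"
    proof (cases "i \<in> {1..n}")
      case True
      then have "(i, \<sigma> i) \<in> perm_graph n \<tau>"
        unfolding eq[symmetric] by (auto simp: perm_graph_def)
      then show ?thesis by (auto simp: perm_graph_def)
    next
      case False
      then show ?thesis
        using perms by (auto simp: perms_def permutes_not_in)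
    qed
  qed
next
  show "perm_graph n ` perms n = {R \<in> rooks n n. card (open_rows n R) = 0}"
  proof (intro subset_antisym subsetI)
    fix R assume "R \<in> perm_graph n ` perms n"
    then obtain \<sigma> where \<sigma>: "\<sigma> permutes {1..n}" "R = perm_graph n \<sigma>"
      by (auto simp: perms_def)
    have "R \<subseteq> {1..n} \<times> {1..n}"
      unfolding \<sigma>(2) perm_graph_def using permutes_in_image[OF \<sigma>(1)] by blast
    moreover have "inj_on fst R" "inj_on snd R"
      by (auto simp: \<sigma>(2) perm_graph_def inj_on_def dest: injD[OF permutes_inj[OF \<sigma>(1)]])
    moreover have "open_rows n R = {}"
      by (auto simp: \<sigma>(2) perm_graph_def open_rows_def image_image)
    ultimately show "R \<in> {R \<in> rooks n n. card (open_rows n R) = 0}"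
      by (simp add: rooks_def)
  next
    fix R assume "R \<in> {R \<in> rooks n n. card (open_rows n R) = 0}"
    then have R: "R \<subseteq> {1..n} \<times> {1..n}" "inj_on fst R" "inj_on snd R" and "open_rows n R = {}"
      by (auto simp: rooks_def)
    then have "\<forall>i\<in>{1..n}. \<exists>v. (i, v) \<in> R"
      by (fastforce simp: open_rows_def)
    then obtain \<rho> where \<rho>: "\<And>i. i \<in> {1..n} \<Longrightarrow> (i, \<rho> i) \<in> R"
      by metis
    define \<sigma> where "\<sigma> i = (if i \<in> {1..n} then \<rho> i else i)" for i
    have "inj_on \<sigma> {1..n}"
    proof (rule inj_onI)
      fix i j assume ij: "i \<in> {1..n}" "j \<in> {1..n}" and "\<sigma> i = \<sigma> j"
      then have "\<rho> i = \<rho> j" by (simp add: \<sigma>_def)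
      then show "i = j"
        using inj_onD[OF R(3) _ \<rho>[OF ij(1)] \<rho>[OF ij(2)]] by simp
    qed
    moreover have "\<rho> i \<in> {1..n}" if "i \<in> {1..n}" for i
      using \<rho>[OF that] R(1) by blast
    then have "\<sigma> ` {1..n} \<subseteq> {1..n}"
      unfolding \<sigma>_def by auto
    ultimately have "bij_betw \<sigma> {1..n} {1..n}"
      by (simp add: bij_betw_def endo_inj_surj)
    then have "\<sigma> permutes {1..n}"
      by (rule bij_imp_permutes) (simp only: \<sigma>_def if_False)
    moreover have "R = perm_graph n \<sigma>"
    proof (intro subset_antisym subsetI)
      fix x assume x: "x \<in> R"
      then have i: "fst x \<in> {1..n}" using R(1) by auto
      then have "x = (fst x, \<sigma> (fst x))"
        using inj_onD[OF R(2) _ x \<rho>[OF i]] by (simp add: \<sigma>_def)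
      then show "x \<in> perm_graph n \<sigma>"
        unfolding perm_graph_def using i by (rule image_eqI)
    next
      fix x assume "x \<in> perm_graph n \<sigma>"
      then show "x \<in> R"
        using \<rho> by (auto simp: perm_graph_def \<sigma>_def)
    qed
    ultimately show "R \<in> perm_graph n ` perms n"
      by (auto simp: perms_def)
  qed
qed

lemma rook_weight_perm_graph:
  assumes "\<sigma> \<in> perms n"
  shows "rook_weight n n (perm_graph n \<sigma>) = X\<^sub>q ^ inv_stat n \<sigma> * X\<^sub>p ^ fix_stat n \<sigma> *
    X\<^sub>s ^ exc_stat n \<sigma> * X\<^sub>t ^ depth_stat n \<sigma>"
proof -
  have \<sigma>: "\<sigma> permutes {1..n}"
    using assms by (simp add: perms_def)
  have inj: "inj_on (\<lambda>i. (i, \<sigma> i)) A" for A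
    by (simp add: inj_on_def)
  have open_empty: "open_rows n (perm_graph n \<sigma>) = {}" "open_cols n (perm_graph n \<sigma>) = {}"
    by (simp_all add: open_rows_def open_cols_def perm_graph_def image_image permutes_image[OF \<sigma>]
        del: One_nat_def)
  have "inv_stat n \<sigma> = card (SIGMA i:{1..n}. {j \<in> {1..n}. i < j \<and> \<sigma> j < \<sigma> i})"
    unfolding inv_stat_def by (intro arg_cong[of _ _ card]) auto
  then have inv: "rook_inv (perm_graph n \<sigma>) {} {} = inv_stat n \<sigma>"
    by (simp add: rook_inv_def perm_graph_def sum.reindex[OF inj] Int_def)
  have "{x \<in> perm_graph n \<sigma>. P (fst x) (snd x)} = (\<lambda>i. (i, \<sigma> i)) ` {i \<in> {1..n}. P i (\<sigma> i)}" for P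
    by (auto simp: perm_graph_def)
  then have card_eq: "card {x \<in> perm_graph n \<sigma>. P (fst x) (snd x)} = card {i \<in> {1..n}. P i (\<sigma> i)}" for P
    by (simp add: card_image[OF inj])
  \<comment> \<open>Away from excedances the truncated difference is 0.\<close>
  have "depth_stat n \<sigma> = (\<Sum>i\<in>{1..n}. \<sigma> i - i)"
    unfolding depth_stat_def by (rule sum.mono_neutral_left) auto
  then have depth: "rook_depth n (perm_graph n \<sigma>) {} = depth_stat n \<sigma>"
    by (simp add: rook_depth_def perm_graph_def sum.reindex[OF inj])
  have "{i \<in> {1..n}. i = \<sigma> i} = {i \<in> {1..n}. \<sigma> i = i}" by auto
  then have "rook_fix (perm_graph n \<sigma>) = fix_stat n \<sigma>" "rook_exc n (perm_graph n \<sigma>) {} = exc_stat n \<sigma>"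
    using card_eq[of "(=)"] card_eq[of "(<)"]
    by (simp_all add: rook_fix_def fix_stat_def rook_exc_def exc_stat_def)
  then show ?thesis
    by (simp add: rook_weight_def open_empty inv depth)
qed

lemma sum_perms:
  "(\<Sum>\<sigma>\<in>perms n. X\<^sub>q ^ inv_stat n \<sigma> * X\<^sub>p ^ fix_stat n \<sigma> * X\<^sub>s ^ exc_stat n \<sigma> * X\<^sub>t ^ depth_stat n \<sigma>)
    = perm_gf n 0"
proof -
  \<comment> \<open>With no steps remaining, \<open>perm_gf 0\<close> is the indicator of complete
    placements.\<close>
  have "perm_gf n 0 = (\<Sum>R\<in>rooks n n. rook_weight n n R * of_bool (card (open_rows n R) = 0))"
    using sum_rooks_perm_gf[of n 0] by simp
  also have "\<dots> = (\<Sum>R | R \<in> rooks n n \<and> card (open_rows n R) = 0. rook_weight n n R)"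
    by (rule sum.mono_neutral_cong_right) (auto simp: finite_rooks)
  also have "\<dots> = (\<Sum>\<sigma>\<in>perms n. rook_weight n n (perm_graph n \<sigma>))"
    by (rule sum.reindex_bij_betw[OF bij_betw_perm_graph, symmetric])
  also have "\<dots> = (\<Sum>\<sigma>\<in>perms n. X\<^sub>q ^ inv_stat n \<sigma> * X\<^sub>p ^ fix_stat n \<sigma> * X\<^sub>s ^ exc_stat n \<sigma>
      * X\<^sub>t ^ depth_stat n \<sigma>)"
    by (rule sum.cong[OF refl]) (rule rook_weight_perm_graph)
  finally show ?thesis by simp
qed

theorem theorem1p1:
  shows "(\<forall>n. \<exists>\<Psi>. bij_betw \<Psi> (perms n) (weighted_paths n) \<and>
            (\<forall>\<sigma> \<in> perms n. path_weight (\<Psi> \<sigma>) =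
               X\<^sub>q ^ inv_stat n \<sigma> * X\<^sub>p ^ fix_stat n \<sigma> *
               X\<^sub>s ^ exc_stat n \<sigma> * X\<^sub>t ^ depth_stat n \<sigma>)) \<and>
         Abs_fps (\<lambda>n. \<Sum>\<sigma> \<in> perms n.
            X\<^sub>q ^ inv_stat n \<sigma> * X\<^sub>p ^ fix_stat n \<sigma> *
            X\<^sub>s ^ exc_stat n \<sigma> * X\<^sub>t ^ depth_stat n \<sigma>) =
         jfrac
           (\<lambda>h. ((1 + X\<^sub>s) * q_int h + X\<^sub>p * X\<^sub>q ^ h) * (X\<^sub>q * X\<^sub>t) ^ h)
           (\<lambda>h. X\<^sub>s * q_int h ^ 2 * (X\<^sub>q * X\<^sub>t) ^ (2 * h - 1))"
proof (intro conjI allI)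
  fix n
  \<comment> \<open>Both are the \<open>n\<close>-th coefficient of the same continued
    fraction.\<close>
  have gf_eq: "perm_gf n 0 = path_gf n 0"
    using perm_gf_jfrac path_gf_jfrac by (metis fps_nth_Abs_fps)
  show "\<exists>\<Psi>. bij_betw \<Psi> (perms n) (weighted_paths n) \<and>
            (\<forall>\<sigma> \<in> perms n. path_weight (\<Psi> \<sigma>) =
               X\<^sub>q ^ inv_stat n \<sigma> * X\<^sub>p ^ fix_stat n \<sigma> *
               X\<^sub>s ^ exc_stat n \<sigma> * X\<^sub>t ^ depth_stat n \<sigma>)"
    unfolding weighted_paths_eq
  proof (rule bij_betw_of_sum_monomials)
    show "finite (perms n)"
      by (simp add: perms_def finite_permutations)
    show "(\<Sum>\<sigma>\<in>perms n. X\<^sub>q ^ inv_stat n \<sigma> * X\<^sub>p ^ fix_stat n \<sigma> * X\<^sub>s ^ exc_stat n \<sigma>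
        * X\<^sub>t ^ depth_stat n \<sigma>) = sum path_weight (wpaths_from n 0)"
      by (simp only: sum_perms gf_eq path_gf_def)
  qed (auto simp: finite_wpaths_from path_weight_monomials)
qed (simp add: sum_perms perm_gf_jfrac)

end
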